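(* Let $\xi,\eta\in c_0^*$ with $\xi\prec\eta$. Then there is some $\rho\in c_0^*$ such that $\xi\le\rho$ (termwise) and $\rho\preccurlyeq\eta$.
   Context: $\mathbb N=\{1,2,3,\dots\}$. $c_0^*$ denotes the cone of nonincreasing sequences $\xi=\langle\xi_1,\xi_2,\dots\rangle$ of nonnegative real numbers converging to $0$ (it does not denote a dual space). For $\xi,\eta\in c_0^*$: $\xi\le\eta$ means $\xi_n\le\eta_n$ for all $n$; $\xi\prec\eta$ ($\eta$ majorizes $\xi$) means $\sum_{j=1}^n\xi_j\le\sum_{j=1}^n\eta_j$ for every $n\in\mathbb N$; $\xi\preccurlyeq\eta$ ($\eta$ strongly majorizes $\xi$) means $\xi\prec\eta$ and $\liminf_{n\to\infty}\sum_{j=1}^n(\eta_j-\xi_j)=0$. *)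

theory Defs
  imports Complex_Main "HOL-Library.Extended_Real"
begin

(* Sequences are indexed from 0: the value at n is the mathematical (n+1)-st term, so the sum
   over j \<le> n is the sum of the first n+1 terms, and n ranging over nat covers exactly the
   partial sums of length 1, 2, 3, ... *)

definition c0_star :: "(nat \<Rightarrow> real) set" where
  "c0_star = {\<xi>. decseq \<xi> \<and> (\<forall>n. 0 \<le> \<xi> n) \<and> \<xi> \<longlonglongrightarrow> 0}"

definition majorized :: "(nat \<Rightarrow> real) \<Rightarrow> (nat \<Rightarrow> real) \<Rightarrow> bool" where
  "majorized \<xi> \<eta> \<longleftrightarrow> (\<forall>n. (\<Sum>j\<le>n. \<xi> j) \<le> (\<Sum>j\<le>n. \<eta> j))"

(* The liminf is taken in the extended reals, since the sums may be unbounded. *)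

definition strongly_majorized :: "(nat \<Rightarrow> real) \<Rightarrow> (nat \<Rightarrow> real) \<Rightarrow> bool" where
  "strongly_majorized \<xi> \<eta> \<longleftrightarrow>
     majorized \<xi> \<eta> \<and> liminf (\<lambda>n. ereal (\<Sum>j\<le>n. \<eta> j - \<xi> j)) = 0"

end

theory Submission
  imports Defs
begin

text \<open>
  By Zorn's lemma there is a termwise maximal \<open>\<rho>\<close> among the decreasing nonnegative sequences
  above \<open>\<xi>\<close> that are majorized by \<open>\<eta>\<close>; being majorized by \<open>\<eta>\<close> forces \<open>\<rho>\<close> to tend to \<open>0\<close>.
  Let \<open>D n\<close> be the \<open>n\<close>-th partial sum of \<open>\<eta> - \<rho>\<close>. If \<open>liminf D > 0\<close>, let \<open>m\<close> be the least index
  from which on \<open>D\<close> is bounded away from \<open>0\<close>. If \<open>m > 0\<close>, minimality gives \<open>D (m - 1) = 0 < D m\<close>,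
  hence \<open>\<rho> m < \<eta> m \<le> \<eta> (m - 1) \<le> \<rho> (m - 1)\<close>. So \<open>\<rho> m\<close> can be increased a little,
  contradicting maximality.
\<close>

text \<open>If the limit \<open>L\<close> were positive, \<open>\<eta>\<close> would eventually stay
  below \<open>L / 2\<close> while \<open>\<rho>\<close> stays above \<open>L\<close>. Each further
  term would then lower the gap between the partial sums by at least \<open>L / 2\<close>, making it
  negative in the end.\<close>

lemma decseq_majorized_tendsto_0:
  fixes \<rho> \<eta> :: "nat \<Rightarrow> real"
  assumes dec: "decseq \<rho>" and nonneg: "\<And>n. 0 \<le> \<rho> n"
    and maj: "majorized \<rho> \<eta>" and lim: "\<eta> \<longlonglongrightarrow> 0"
  shows "\<rho> \<longlonglongrightarrow> 0"
proof -
  obtain L where L: "\<rho> \<longlonglongrightarrow> L" and ge: "\<And>n. L \<le> \<rho> n"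
    using decseq_convergent[OF dec] nonneg by metis
  have "L \<ge> 0" using LIMSEQ_le_const[OF L] nonneg by blast
  moreover have "\<not> L > 0"
  proof
    assume "L > 0"
    then obtain N where N: "\<And>n. n \<ge> N \<Longrightarrow> \<eta> n < L / 2"
      using order_tendstoD(2)[OF lim, of "L / 2"] by (auto simp: eventually_sequentially)
    define D where "D n = (\<Sum>j\<le>n. \<eta> j) - (\<Sum>j\<le>n. \<rho> j)" for n
    have "D (N + k) \<le> D N - k * (L / 2)" for k
    proof (induction k)
      case (Suc k)
      then show ?case
        using N[of "Suc (N + k)"] ge[of "Suc (N + k)"] by (simp add: D_def algebra_simps add_divide_distrib)
    qed simp
    moreover have "D n \<ge> 0" for n
      using maj by (simp add: D_def majorized_def)
    moreover obtain k :: nat where "D N < k * (L / 2)"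
      using ex_less_of_nat_mult[of "L / 2"] \<open>L > 0\<close> by auto
    ultimately show False by (meson diff_less_0_iff_less le_less_trans not_le)
  qed
  ultimately show ?thesis using L by simp
qed

text \<open>These conditions all pass to suprema of chains, as Zorn's lemma requires. Membership in
  \<open>c0_star\<close> is recovered afterwards: nonnegativity from that of \<open>\<xi>\<close>,
  convergence from \<open>decseq_majorized_tendsto_0\<close>.\<close>

definition intermediate :: "(nat \<Rightarrow> real) \<Rightarrow> (nat \<Rightarrow> real) \<Rightarrow> (nat \<Rightarrow> real) set" where
  "intermediate \<xi> \<eta> = {\<rho>. decseq \<rho> \<and> \<xi> \<le> \<rho> \<and> majorized \<rho> \<eta>}"

text \<open>Each coordinate has its own near-optimal member; among finitely many members of a chain
  the largest serves all coordinates at once.\<close>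

lemma chain_approximates_SUP:
  fixes C :: "(nat \<Rightarrow> real) set" and e :: real
  assumes ne: "C \<noteq> {}" and chain: "\<And>f g. f \<in> C \<Longrightarrow> g \<in> C \<Longrightarrow> f \<le> g \<or> g \<le> f"
    and bdd: "\<And>n. bdd_above ((\<lambda>f. f n) ` C)" and "e > 0"
  shows "\<exists>f\<in>C. \<forall>j\<le>n. (SUP g\<in>C. g j) - e < f j"
proof (induction n)
  case 0
  show ?case using less_cSUP_iff[OF ne bdd, of "(SUP g\<in>C. g 0) - e" 0] \<open>e > 0\<close> by auto
next
  case (Suc n)
  then obtain f where f: "f \<in> C" "\<forall>j\<le>n. (SUP g\<in>C. g j) - e < f j" by blast
  obtain g where g: "g \<in> C" "(SUP g\<in>C. g (Suc n)) - e < g (Suc n)"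
    using less_cSUP_iff[OF ne bdd, of "(SUP g\<in>C. g (Suc n)) - e" "Suc n"] \<open>e > 0\<close> by auto
  from chain[OF f(1) g(1)] show ?case
  proof
    assume "f \<le> g"
    then have "\<forall>j\<le>Suc n. (SUP g\<in>C. g j) - e < g j"
      using f(2) g(2) less_le_trans[OF _ le_funD[OF \<open>f \<le> g\<close>]] by (auto simp: le_Suc_eq)
    then show ?thesis using g(1) by blast
  next
    assume "g \<le> f"
    then have "\<forall>j\<le>Suc n. (SUP g\<in>C. g j) - e < f j"
      using f(2) g(2) less_le_trans[OF _ le_funD[OF \<open>g \<le> f\<close>]] by (auto simp: le_Suc_eq)
    then show ?thesis using f(1) by blast
  qed
qed

lemma intermediate_SUP:
  fixes \<xi> \<eta> :: "nat \<Rightarrow> real"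
  assumes nonneg: "\<And>n. 0 \<le> \<xi> n" and sub: "C \<subseteq> intermediate \<xi> \<eta>" and ne: "C \<noteq> {}"
    and chain: "\<And>f g. f \<in> C \<Longrightarrow> g \<in> C \<Longrightarrow> f \<le> g \<or> g \<le> f"
  defines "s \<equiv> \<lambda>n. SUP f\<in>C. f n"
  shows "s \<in> intermediate \<xi> \<eta>" and "\<And>f. f \<in> C \<Longrightarrow> f \<le> s"
proof -
  \<comment> \<open>The terms of \<open>f\<close> are nonnegative, so each is at most a partial sum.
    This bounds the chain coordinatewise, so that its real suprema behave as intended.\<close>
  have f_le: "f n \<le> (\<Sum>j\<le>n. \<eta> j)" if "f \<in> C" for f n
  proof -
    have f: "\<And>k. 0 \<le> f k" "majorized f \<eta>"
      using that sub order_trans[OF nonneg] by (auto simp: intermediate_def le_fun_def)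
    have "f n \<le> (\<Sum>j\<le>n. f j)" by (rule member_le_sum) (auto simp: f)
    also have "\<dots> \<le> (\<Sum>j\<le>n. \<eta> j)" using f(2) by (simp add: majorized_def)
    finally show ?thesis .
  qed
  then have bdd: "bdd_above ((\<lambda>f. f n) ` C)" for n by (rule bdd_aboveI2)
  have up: "f n \<le> s n" if "f \<in> C" for f n
    unfolding s_def using that bdd by (intro cSUP_upper)
  then show le_s: "\<And>f. f \<in> C \<Longrightarrow> f \<le> s" by (simp add: le_fun_def)
  have "decseq s"
    unfolding decseq_def
  proof (intro allI impI)
    fix m n :: nat
    assume "m \<le> n"
    then have "f n \<le> s m" if "f \<in> C" for f
      using that sub order_trans[OF _ up[OF that, of m]] by (auto simp: intermediate_def decseq_def)
    with ne have "(SUP f\<in>C. f n) \<le> s m" by (rule cSUP_least)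
    then show "s n \<le> s m" by (simp add: s_def)
  qed
  moreover obtain f where "f \<in> C" using ne by blast
  then have "\<xi> \<le> s" using sub order_trans[OF _ le_s] by (auto simp: intermediate_def)
  moreover have "majorized s \<eta>"
    unfolding majorized_def
  proof (rule allI, rule field_le_epsilon)
    fix n and e :: real
    assume "e > 0"
    \<comment> \<open>The error is shared equally among the \<open>n + 1\<close> terms of the
      partial sum.\<close>
    define d where "d = e / Suc n"
    have "d > 0" using \<open>e > 0\<close> by (simp add: d_def)
    from chain_approximates_SUP[OF ne chain bdd this, of n]
    obtain f where f: "f \<in> C" "\<And>j. j \<le> n \<Longrightarrow> s j - d < f j"
      unfolding s_def by blast
    have "s j \<le> f j + d" if "j \<le> n" for j
      using f(2)[OF that] by linarith
    then have "(\<Sum>j\<le>n. s j) \<le> (\<Sum>j\<le>n. f j + d)" by (intro sum_mono) simp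
    also have "\<dots> = (\<Sum>j\<le>n. f j) + e" by (simp add: sum.distrib d_def)
    also have "\<dots> \<le> (\<Sum>j\<le>n. \<eta> j) + e" using f(1) sub by (auto simp: intermediate_def majorized_def)
    finally show "(\<Sum>j\<le>n. s j) \<le> (\<Sum>j\<le>n. \<eta> j) + e" .
  qed
  ultimately show "s \<in> intermediate \<xi> \<eta>" by (simp add: intermediate_def)
qed

lemma intermediate_maximal_exists:
  fixes \<xi> \<eta> :: "nat \<Rightarrow> real"
  assumes "decseq \<xi>" and "\<And>n. 0 \<le> \<xi> n" and "majorized \<xi> \<eta>"
  shows "\<exists>\<rho>\<in>intermediate \<xi> \<eta>. \<forall>\<sigma>\<in>intermediate \<xi> \<eta>. \<rho> \<le> \<sigma> \<longrightarrow> \<sigma> = \<rho>"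
proof (rule predicate_Zorn)
  show "partial_order_on (intermediate \<xi> \<eta>) (relation_of (\<le>) (intermediate \<xi> \<eta>))"
    by (rule partial_order_on_relation_ofI) auto
next
  fix C
  assume C: "C \<in> Chains (relation_of (\<le>) (intermediate \<xi> \<eta>))"
  have mem: "\<xi> \<in> intermediate \<xi> \<eta>" using assms by (simp add: intermediate_def)
  have sub: "C \<subseteq> intermediate \<xi> \<eta>"
    and chain: "\<And>f g. f \<in> C \<Longrightarrow> g \<in> C \<Longrightarrow> f \<le> g \<or> g \<le> f"
    using C by (auto simp: Chains_def relation_of_def)
  show "\<exists>u\<in>intermediate \<xi> \<eta>. \<forall>f\<in>C. f \<le> u"
  proof (cases "C = {}")
    case True
    then show ?thesis using mem by blast
  next
    case False
    note SUP = intermediate_SUP[OF assms(2) sub False chain]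
    show ?thesis by (intro bexI[OF _ SUP(1)] ballI SUP(2))
  qed
qed

lemma liminf_eq_0_if_maximal:
  fixes \<xi> \<eta> :: "nat \<Rightarrow> real"
  assumes dec: "decseq \<eta>" and mem: "\<rho> \<in> intermediate \<xi> \<eta>"
    and maximal: "\<forall>\<sigma>\<in>intermediate \<xi> \<eta>. \<rho> \<le> \<sigma> \<longrightarrow> \<sigma> = \<rho>"
  shows "liminf (\<lambda>n. ereal (\<Sum>j\<le>n. \<eta> j - \<rho> j)) = 0"
proof (rule ccontr)
  define D where "D n = (\<Sum>j\<le>n. \<eta> j - \<rho> j)" for n
  have dec': "decseq \<rho>" and le: "\<xi> \<le> \<rho>" and maj: "majorized \<rho> \<eta>"
    using mem by (auto simp: intermediate_def)
  have nonneg: "D n \<ge> 0" for n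
    using maj by (simp add: D_def majorized_def sum_subtractf)
  assume "liminf (\<lambda>n. ereal (\<Sum>j\<le>n. \<eta> j - \<rho> j)) \<noteq> 0"
  then have "liminf (\<lambda>n. ereal (D n)) \<noteq> 0" by (simp add: D_def)
  moreover have "liminf (\<lambda>n. ereal (D n)) \<ge> 0"
    using nonneg by (intro Liminf_bounded) auto
  ultimately have "ereal 0 < liminf (\<lambda>n. ereal (D n))" by (simp add: zero_ereal_def)
  \<comment> \<open>The liminf may be infinite, so a real number strictly below it is taken.\<close>
  then obtain c where "ereal 0 < ereal c" "ereal c < liminf (\<lambda>n. ereal (D n))"
    using ereal_dense2 by blast
  then have "0 < c" and "\<forall>\<^sub>F n in sequentially. c < D n"
    by (auto dest: less_LiminfD)
  then have ex: "\<exists>m. \<exists>e>0. \<forall>n\<ge>m. e \<le> D n"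
    by (auto simp: eventually_sequentially intro: less_imp_le)
  define m where "m = (LEAST m. \<exists>e>0. \<forall>n\<ge>m. e \<le> D n)"
  obtain e where e: "e > 0" "\<And>n. n \<ge> m \<Longrightarrow> e \<le> D n"
    using LeastI_ex[OF ex] unfolding m_def by blast
  \<comment> \<open>The bound by \<open>e\<close> will preserve majorization, the bound by the
    preceding term monotonicity. For \<open>m = 0\<close> there is no preceding term and
    \<open>e\<close> itself serves.\<close>
  have "\<exists>d>0. d \<le> e \<and> (\<forall>k. m = Suc k \<longrightarrow> \<rho> m + d \<le> \<rho> k)"
  proof (cases m)
    case (Suc k)
    have "D k = 0"
    proof (rule ccontr)
      \<comment> \<open>Otherwise \<open>min e (D k)\<close> would be a positive lower bound already
        from \<open>k\<close> on, against the minimality of \<open>m\<close>.\<close>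
      assume "D k \<noteq> 0"
      with nonneg[of k] have "0 < min e (D k)" using e(1) by simp
      moreover have "min e (D k) \<le> D n" if "n \<ge> k" for n
        using e(2)[of n] Suc that by (cases "n = k") auto
      ultimately have "m \<le> k" unfolding m_def by (intro Least_le) blast
      then show False using Suc by simp
    qed
    \<comment> \<open>\<open>D\<close> reaches 0 at \<open>k\<close> from a nonnegative value (the
      empty sum if \<open>k = 0\<close>), so its last increment is not positive.\<close>
    have "\<eta> k \<le> \<rho> k"
    proof (cases k)
      case 0
      then show ?thesis using \<open>D k = 0\<close> by (simp add: D_def)
    next
      case (Suc l)
      then show ?thesis using \<open>D k = 0\<close> nonneg[of l] by (simp add: D_def)
    qed
    moreover have "\<eta> m - \<rho> m = D m" using \<open>D k = 0\<close> Suc by (simp add: D_def)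
    moreover have "\<eta> m \<le> \<eta> k" using dec Suc by (simp add: decseq_Suc_iff)
    ultimately have "\<rho> m < \<rho> k" using e by fastforce
    then show ?thesis
      using e(1) Suc by (intro exI[of _ "min e (\<rho> k - \<rho> m)"]) (auto simp: min_def)
  qed (use e in auto)
  then obtain d where d: "d > 0" "d \<le> e" "\<And>k. m = Suc k \<Longrightarrow> \<rho> m + d \<le> \<rho> k" by blast
  define \<sigma> where "\<sigma> j = \<rho> j + (if j = m then d else 0)" for j
  have "\<rho> \<le> \<sigma>" using d(1) by (simp add: \<sigma>_def le_fun_def)
  moreover have "decseq \<sigma>"
    unfolding decseq_Suc_iff
  proof
    fix k
    show "\<sigma> (Suc k) \<le> \<sigma> k"
      using decseq_SucD[OF dec', of k] d(1) d(3)[of k] by (auto simp: \<sigma>_def)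
  qed
  moreover have "majorized \<sigma> \<eta>"
    unfolding majorized_def
  proof
    fix n
    \<comment> \<open>Partial sums before \<open>m\<close> are unchanged; from \<open>m\<close> on
      they grow by \<open>d\<close>, which fits into the slack because
      \<open>d \<le> e \<le> D n\<close>.\<close>
    have "(\<Sum>j\<le>n. \<sigma> j) = (\<Sum>j\<le>n. \<rho> j) + (if m \<le> n then d else 0)"
      by (simp add: \<sigma>_def sum.distrib)
    also have "(if m \<le> n then d else 0) \<le> D n" using e(2)[of n] d(2) nonneg[of n] by auto
    finally show "(\<Sum>j\<le>n. \<sigma> j) \<le> (\<Sum>j\<le>n. \<eta> j)" by (simp add: D_def sum_subtractf)
  qed
  ultimately have "\<sigma> = \<rho>"
    using maximal order.trans[OF le] by (simp add: intermediate_def)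
  then have "\<sigma> m = \<rho> m" by simp
  then show False using d(1) by (simp add: \<sigma>_def)
qed

theorem theorem3p4:
  fixes \<xi> \<eta> :: "nat \<Rightarrow> real"
  assumes "\<xi> \<in> c0_star" and "\<eta> \<in> c0_star" and "majorized \<xi> \<eta>"
  shows "\<exists>\<rho>\<in>c0_star. (\<forall>n. \<xi> n \<le> \<rho> n) \<and> strongly_majorized \<rho> \<eta>"
proof -
  have \<xi>: "decseq \<xi>" "\<And>n. 0 \<le> \<xi> n" and \<eta>: "decseq \<eta>" "\<eta> \<longlonglongrightarrow> 0"
    using assms by (auto simp: c0_star_def)
  obtain \<rho> where \<rho>: "\<rho> \<in> intermediate \<xi> \<eta>"
    and maximal: "\<forall>\<sigma>\<in>intermediate \<xi> \<eta>. \<rho> \<le> \<sigma> \<longrightarrow> \<sigma> = \<rho>"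
    using intermediate_maximal_exists[OF \<xi> assms(3)] by blast
  from \<rho> have dec: "decseq \<rho>" and le: "\<And>n. \<xi> n \<le> \<rho> n" and maj: "majorized \<rho> \<eta>"
    by (auto simp: intermediate_def le_fun_def)
  have nonneg: "0 \<le> \<rho> n" for n using \<xi>(2) le order_trans by blast
  have "\<rho> \<in> c0_star"
    using dec nonneg decseq_majorized_tendsto_0[OF dec nonneg maj \<eta>(2)] by (simp add: c0_star_def)
  moreover have "strongly_majorized \<rho> \<eta>"
    using maj liminf_eq_0_if_maximal[OF \<eta>(1) \<rho> maximal] by (simp add: strongly_majorized_def)
  ultimately show ?thesis using le by blast
qed

end
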